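(* Let $I$ be a finite set, $V$ a set, and for all $i,j\in I$ let $V_{i,j}\subseteq V$. Let $V=V'\cup V''$ and assume that for all $i,j\in I$, if $V_{i,j}\neq\emptyset$ then $V_{i,j}\cap V'\neq\emptyset$. For each $v\in V$ let $A^v\in\mathbb Z/2\mathbb Z$ with $A^v=0$ for almost all $v$ and $\sum_{v\in V}A^v=0$, and let $\mathcal C^v\subseteq C(I)$ be a subset such that (ii) $\sum_{i\in I}a(i)=A^v$ for every $a\in\mathcal C^v$, and (iii) if $v\in V'$, then $\mathcal C^v$ is stable under the maps $(i,j)$ for all distinct $i,j$ with $i\sim_v j$. Let $\mathcal C$ be the set of families $a=(a^v)_{v\in V}$ with $a^v\in\mathcal C^v$ and $a^v=0$ for almost all $v$. Let $a\in\mathcal C$ be such that $$\sum_{v\in V}\sum_{i\in I}c(i)a^v(i)=0$$ for all $c\in C_\sim(I)$. Then there exists $b=(b^v)\in\mathcal C$ such that $\sum_{v\in V}b^v(i)=0$ for all $i\in I$.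
   Context: $C(I)$ is the group of maps $I\to\mathbb Z/2\mathbb Z$. Let $\sim$ be the equivalence relation on $I$ generated by $i\sim j$ if $V_{i,j}\neq\emptyset$, and $C_\sim(I)$ the subgroup of maps constant on $\sim$-classes; the obstruction group $\text{Ш}$ is $C_\sim(I)$ modulo constant maps (the displayed sum depends only on the class of $c$ in $\text{Ш}$ by the hypotheses). For $v\in V$, $\sim_v$ is the equivalence relation on $I$ generated by $i\sim_v j$ if $v\in V_{i,j}$. For distinct $i,j\in I$, $c_{i,j}\in C(I)$ is the map with value $1$ at $i$ and $j$ and $0$ elsewhere, and $(i,j):C(I)\to C(I)$ is $c\mapsto c+c_{i,j}$. *)

theory Defs
  imports Main "HOL-Library.FuncSet" "HOL-Library.Z2"
begin

text \<open>
  The group \<open>\<int>/2\<int>\<close> is the type \<^typ>\<open>bit\<close>. Maps on \<open>I\<close> and families over \<open>V\<close> are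
  represented by extensional functions.
\<close>

definition cmaps :: "'i set \<Rightarrow> ('i \<Rightarrow> bit) set" where
  "cmaps I = (I \<rightarrow>\<^sub>E UNIV)"

definition zero_map :: "'i set \<Rightarrow> 'i \<Rightarrow> bit" where
  "zero_map I = (\<lambda>k\<in>I. 0)"

definition pair_map :: "'i set \<Rightarrow> 'i \<Rightarrow> 'i \<Rightarrow> 'i \<Rightarrow> bit" where
  "pair_map I i j = (\<lambda>k\<in>I. if k = i \<or> k = j then 1 else 0)"

definition flip_pair :: "'i set \<Rightarrow> 'i \<Rightarrow> 'i \<Rightarrow> ('i \<Rightarrow> bit) \<Rightarrow> 'i \<Rightarrow> bit" where
  "flip_pair I i j c = (\<lambda>k\<in>I. c k + pair_map I i j k)"

definition equiv_on_gen :: "'i set \<Rightarrow> ('i \<Rightarrow> 'i \<Rightarrow> bool) \<Rightarrow> 'i \<Rightarrow> 'i \<Rightarrow> bool" where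
  "equiv_on_gen I R i j \<longleftrightarrow>
     i \<in> I \<and> j \<in> I \<and> equivclp (\<lambda>k l. k \<in> I \<and> l \<in> I \<and> R k l) i j"

definition link :: "'i set \<Rightarrow> ('i \<Rightarrow> 'i \<Rightarrow> 'v set) \<Rightarrow> 'i \<Rightarrow> 'i \<Rightarrow> bool" where
  "link I W = equiv_on_gen I (\<lambda>i j. W i j \<noteq> {})"

definition link_at :: "'i set \<Rightarrow> ('i \<Rightarrow> 'i \<Rightarrow> 'v set) \<Rightarrow> 'v \<Rightarrow> 'i \<Rightarrow> 'i \<Rightarrow> bool" where
  "link_at I W v = equiv_on_gen I (\<lambda>i j. v \<in> W i j)"

definition cmaps_link :: "'i set \<Rightarrow> ('i \<Rightarrow> 'i \<Rightarrow> 'v set) \<Rightarrow> ('i \<Rightarrow> bit) set" where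
  "cmaps_link I W = {c \<in> cmaps I. \<forall>i j. link I W i j \<longrightarrow> c i = c j}"

definition families :: "'i set \<Rightarrow> 'v set \<Rightarrow> ('v \<Rightarrow> ('i \<Rightarrow> bit) set) \<Rightarrow> ('v \<Rightarrow> 'i \<Rightarrow> bit) set" where
  "families I V \<C> = {a \<in> (\<Pi>\<^sub>E v\<in>V. \<C> v). finite {v \<in> V. a v \<noteq> zero_map I}}"

end

theory Submission
  imports Defs
begin

text \<open>
  Write \<open>s\<^sub>b(i)\<close> for the sum of \<open>b\<^sup>v(i)\<close> over \<open>v\<close>. Flipping \<open>b\<^sup>v\<close> at \<open>i\<close>, \<open>j\<close> for some
  \<open>v\<close> in \<open>V\<^sub>i\<^sub>j \<inter> V'\<close> adds \<open>c\<^sub>i\<^sub>j\<close> to \<open>s\<^sub>b\<close>; chaining such flips achieves this whenever \<open>i \<sim> j\<close>.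
  The orthogonality hypothesis says that \<open>s\<^sub>a\<close> has an even number of nonzero values on every
  \<open>\<sim>\<close>-class, and it is preserved by the flips, so the nonzero values can be cancelled in pairs.
\<close>

text \<open>\<open>sum'\<close> adds up over the support of \<open>f\<close>, which varies with
  \<open>f\<close>. Passing to a finite superset lets two families be compared over one common index
  set.\<close>

lemma sum'_eq_sum_superset:
  assumes "finite F" "F \<subseteq> V" "\<And>v. v \<in> V - F \<Longrightarrow> f v = 0"
  shows "sum' f V = sum f F"
proof -
  have "sum' f V = sum' f F"
    using assms by (intro sum.mono_neutral_right') auto
  then show ?thesis
    using assms(1) by (simp add: sum.eq_sum)
qed

lemma families_mem: "b \<in> families I V \<C> \<Longrightarrow> v \<in> V \<Longrightarrow> b v \<in> \<C> v"
  by (auto simp: families_def)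

lemma families_finite_support:
  "b \<in> families I V \<C> \<Longrightarrow> finite {v \<in> V. b v \<noteq> zero_map I}"
  by (simp add: families_def)

lemma families_upd:
  assumes "b \<in> families I V \<C>" "v \<in> V" "x \<in> \<C> v"
  shows "b(v := x) \<in> families I V \<C>"
proof -
  have "finite {w \<in> V. (b(v := x)) w \<noteq> zero_map I}"
    by (rule finite_subset[of _ "insert v {w \<in> V. b w \<noteq> zero_map I}"])
      (use families_finite_support[OF assms(1)] in auto)
  then show ?thesis
    using assms by (auto simp: families_def PiE_iff extensional_def)
qed

lemma sum'_families_eq:
  assumes "b \<in> families I V \<C>" "finite F" "F \<subseteq> V" "{v \<in> V. b v \<noteq> zero_map I} \<subseteq> F" "k \<in> I"
  shows "sum' (\<lambda>v. b v k) V = (\<Sum>v\<in>F. b v k)"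
proof (rule sum'_eq_sum_superset)
  fix v assume "v \<in> V - F"
  then have "b v = zero_map I" using assms(4) by auto
  then show "b v k = 0" using assms(5) by (simp add: zero_map_def)
qed (use assms in auto)

text \<open>Only the summand at \<open>v\<close> changes. Distinctness matters: for
  \<open>i = j\<close> the two indicators would cancel, while \<open>pair_map\<close> would still be
  1 at \<open>i\<close>.\<close>

lemma sum'_families_upd_flip_pair:
  assumes b: "b \<in> families I V \<C>" and v: "v \<in> V" and ij: "i \<noteq> j"
    and flip: "flip_pair I i j (b v) \<in> \<C> v" and k: "k \<in> I"
  shows "sum' (\<lambda>w. (b(v := flip_pair I i j (b v))) w k) V =
    sum' (\<lambda>w. b w k) V + (of_bool (k = i) + of_bool (k = j))"
proof -
  \<comment> \<open>\<open>v\<close> is inserted because the flip can turn a zero map at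
    \<open>v\<close> into a nonzero one; \<open>F\<close> then contains the supports of both
    families.\<close>
  define F where "F = insert v {w \<in> V. b w \<noteq> zero_map I}"
  have F: "finite F" "F \<subseteq> V" "v \<in> F"
    using families_finite_support[OF b] v by (auto simp: F_def)
  have "sum' (\<lambda>w. (b(v := flip_pair I i j (b v))) w k) V =
      (\<Sum>w\<in>F. (b(v := flip_pair I i j (b v))) w k)"
    by (rule sum'_families_eq[OF families_upd[OF b v flip] F(1,2) _ k]) (auto simp: F_def)
  also have "\<dots> = flip_pair I i j (b v) k + (\<Sum>w\<in>F - {v}. b w k)"
    using F by (subst sum.remove[of F v]) auto
  also have "\<dots> = (b v k + (\<Sum>w\<in>F - {v}. b w k)) + (of_bool (k = i) + of_bool (k = j))"
    using k ij by (auto simp: flip_pair_def pair_map_def ac_simps simp del: add_bit_eq_xor)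
  also have "b v k + (\<Sum>w\<in>F - {v}. b w k) = (\<Sum>w\<in>F. b w k)"
    using F by (simp add: sum.remove[of F v])
  also have "\<dots> = sum' (\<lambda>w. b w k) V"
    by (rule sum'_families_eq[OF b F(1,2) _ k, symmetric]) (auto simp: F_def)
  finally show ?thesis .
qed

text \<open>Interchanging the two sums turns orthogonality into a condition on the pointwise sums
  over \<open>v\<close> alone, which is easy to follow through flips.\<close>

lemma sum'_families_pairing:
  assumes b: "b \<in> families I V \<C>" and "finite I"
  shows "sum' (\<lambda>v. \<Sum>i\<in>I. c i * b v i) V = (\<Sum>i\<in>I. c i * sum' (\<lambda>v. b v i) V)"
proof -
  define F where "F = {w \<in> V. b w \<noteq> zero_map I}"
  have F: "finite F" "F \<subseteq> V"
    using families_finite_support[OF b] by (auto simp: F_def)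
  have "sum' (\<lambda>v. \<Sum>i\<in>I. c i * b v i) V = (\<Sum>v\<in>F. \<Sum>i\<in>I. c i * b v i)"
    by (rule sum'_eq_sum_superset[OF F]) (auto simp: F_def zero_map_def)
  also have "\<dots> = (\<Sum>i\<in>I. c i * (\<Sum>v\<in>F. b v i))"
    by (subst sum.swap) (simp add: sum_distrib_left del: mult_bit_eq_and)
  also have "\<dots> = (\<Sum>i\<in>I. c i * sum' (\<lambda>v. b v i) V)"
    using sum'_families_eq[OF b F] by (intro sum.cong) (auto simp: F_def)
  finally show ?thesis .
qed

lemma link_imp_shift_sum':
  assumes W: "\<And>i j. i \<in> I \<Longrightarrow> j \<in> I \<Longrightarrow> W i j \<noteq> {} \<Longrightarrow> W i j \<inter> V' \<noteq> {}"
    and V': "V' \<subseteq> V"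
    and stable: "\<And>v i j x. v \<in> V' \<Longrightarrow> i \<noteq> j \<Longrightarrow> link_at I W v i j \<Longrightarrow> x \<in> \<C> v \<Longrightarrow>
      flip_pair I i j x \<in> \<C> v"
    and ij: "link I W i j" and b: "b \<in> families I V \<C>"
  shows "\<exists>b' \<in> families I V \<C>. \<forall>k\<in>I.
    sum' (\<lambda>v. b' v k) V = sum' (\<lambda>v. b v k) V + (of_bool (k = i) + of_bool (k = j))"
proof -
  let ?P = "\<lambda>i j b b'. \<forall>k\<in>I.
    sum' (\<lambda>v. b' v k) V = sum' (\<lambda>v. b v k) V + (of_bool (k = i) + of_bool (k = j))"
  let ?R = "\<lambda>k l. k \<in> I \<and> l \<in> I \<and> W k l \<noteq> {}"
  have step: "\<exists>b' \<in> families I V \<C>. ?P i j b b'"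
    if R: "?R i j" and b: "b \<in> families I V \<C>" for i j b
  \<comment> \<open>Stability concerns distinct indices only. For \<open>i = j\<close> the required
    shift is 1 + 1 = 0, so \<open>b\<close> itself serves.\<close>
  proof (cases "i = j")
    case True
    then show ?thesis using b by (intro bexI[of _ b]) auto
  next
    case False
    \<comment> \<open>The place is taken in \<open>V'\<close>, where stability under flips is
      available.\<close>
    obtain v where v: "v \<in> W i j" "v \<in> V'" using W R by blast
    have "link_at I W v i j"
      using R v by (auto simp: link_at_def equiv_on_gen_def intro!: r_into_equivclp)
    then have flip: "flip_pair I i j (b v) \<in> \<C> v"
      using stable v V' False families_mem[OF b, of v] by blast
    have "v \<in> V" using v V' by blast
    then show ?thesis
      using sum'_families_upd_flip_pair[OF b _ False flip] families_upd[OF b _ flip] by blast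
  qed
  \<comment> \<open>\<open>W\<close> need not be symmetric, so a chain in the generated equivalence
    may traverse a link backwards; the shift is symmetric in \<open>i\<close> and
    \<open>j\<close>.\<close>
  have step_sym: "\<exists>b' \<in> families I V \<C>. ?P i j b b'"
    if R: "?R i j \<or> ?R j i" and b: "b \<in> families I V \<C>" for i j b
    using R
  proof
    assume "?R i j"
    then show ?thesis using b by (rule step)
  next
    assume "?R j i"
    then obtain b' where b': "b' \<in> families I V \<C>" "?P j i b b'"
      using step[OF _ b] by blast
    have "?P i j b b'" using b'(2) by auto
    then show ?thesis using b'(1) by blast
  qed
  have "equivclp ?R i j" using ij by (simp add: link_def equiv_on_gen_def)
  then show ?thesis
  proof (induction rule: equivclp_induct)
    case base
    show ?case using b by (intro bexI[of _ b]) auto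
  next
    case (step y z)
    from step.IH obtain b1 where b1: "b1 \<in> families I V \<C>" "?P i y b b1" by blast
    from step_sym[OF step.hyps(2) b1(1)] obtain b2
      where b2: "b2 \<in> families I V \<C>" "?P y z b1 b2" by blast
    \<comment> \<open>The indicators of the intermediate index \<open>y\<close> occur twice and
      cancel modulo 2.\<close>
    have "?P i z b b2"
    proof
      fix k assume "k \<in> I"
      with b1(2) b2(2) show "sum' (\<lambda>v. b2 v k) V =
          sum' (\<lambda>v. b v k) V + (of_bool (k = i) + of_bool (k = z))"
        by (cases "k = i"; cases "k = y"; cases "k = z") simp_all
    qed
    then show ?case using b2(1) by blast
  qed
qed

text \<open>The indicator of a class is the test map that detects the parity of the nonzero sums in
  that class.\<close>

lemma link_indicator_in_cmaps_link:
  assumes "i \<in> I"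
  shows "(\<lambda>k\<in>I. of_bool (link I W i k)) \<in> cmaps_link I W"
  unfolding cmaps_link_def
proof (intro CollectI conjI allI impI)
  show "(\<lambda>k\<in>I. of_bool (link I W i k)) \<in> cmaps I"
    by (simp add: cmaps_def)
  fix k l assume kl: "link I W k l"
  then have "link I W i k \<longleftrightarrow> link I W i l"
    unfolding link_def equiv_on_gen_def
    by (meson equivclp_sym equivclp_trans)
  then show "(\<lambda>k\<in>I. of_bool (link I W i k)) k = ((\<lambda>k\<in>I. of_bool (link I W i k)) l :: bit)"
    using kl by (simp add: link_def equiv_on_gen_def)
qed

theorem theorem13p5:
  fixes I :: "'i set" and V V' V'' :: "'v set"
    and W :: "'i \<Rightarrow> 'i \<Rightarrow> 'v set"
    and A :: "'v \<Rightarrow> bit"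
    and \<C> :: "'v \<Rightarrow> ('i \<Rightarrow> bit) set"
    and a :: "'v \<Rightarrow> 'i \<Rightarrow> bit"
  assumes "finite I"
    and "\<And>i j. i \<in> I \<Longrightarrow> j \<in> I \<Longrightarrow> W i j \<subseteq> V"
    and "V = V' \<union> V''"
    and "\<And>i j. i \<in> I \<Longrightarrow> j \<in> I \<Longrightarrow> W i j \<noteq> {} \<Longrightarrow> W i j \<inter> V' \<noteq> {}"
    and "finite {v \<in> V. A v \<noteq> 0}"
    and "sum' A V = 0"
    and "\<And>v. v \<in> V \<Longrightarrow> \<C> v \<subseteq> cmaps I"
    and "\<And>v x. v \<in> V \<Longrightarrow> x \<in> \<C> v \<Longrightarrow> (\<Sum>i\<in>I. x i) = A v"
    and "\<And>v i j x. v \<in> V' \<Longrightarrow> i \<noteq> j \<Longrightarrow> link_at I W v i j \<Longrightarrow> x \<in> \<C> v \<Longrightarrow>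
           flip_pair I i j x \<in> \<C> v"
    and "a \<in> families I V \<C>"
    and "\<And>c. c \<in> cmaps_link I W \<Longrightarrow> sum' (\<lambda>v. \<Sum>i\<in>I. c i * a v i) V = 0"
  shows "\<exists>b \<in> families I V \<C>. \<forall>i\<in>I. sum' (\<lambda>v. b v i) V = 0"
proof -
  note stable = assms(9)
  have shift: "\<exists>b' \<in> families I V \<C>. \<forall>k\<in>I.
      sum' (\<lambda>v. b' v k) V = sum' (\<lambda>v. b v k) V + (of_bool (k = i) + of_bool (k = j))"
    if "link I W i j" "b \<in> families I V \<C>" for i j b
    by (rule link_imp_shift_sum'[OF assms(4) _ stable that]) (use assms(3) in auto)
  \<comment> \<open>Orthogonality is restated for an arbitrary family \<open>b\<close>, so that it
    can be carried through an induction on the number of indices with nonzero sum.\<close>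
  have reduce: "\<exists>b' \<in> families I V \<C>. \<forall>i\<in>I. sum' (\<lambda>v. b' v i) V = 0"
    if "b \<in> families I V \<C>"
      and "\<And>c. c \<in> cmaps_link I W \<Longrightarrow> (\<Sum>i\<in>I. c i * sum' (\<lambda>v. b v i) V) = 0" for b
    using that
  proof (induction "card {i \<in> I. sum' (\<lambda>v. b v i) V \<noteq> 0}" arbitrary: b rule: less_induct)
    case less
    let ?s = "\<lambda>i. sum' (\<lambda>v. b v i) V"
    show ?case
    proof (cases "\<forall>i\<in>I. ?s i = 0")
      case True
      then show ?thesis using less.prems by blast
    next
      case False
      then obtain i where i: "i \<in> I" "?s i = 1" by (auto simp: bit_not_zero_iff)
      \<comment> \<open>Pairing with the indicator of the class of \<open>i\<close> gives 0, yet the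
        term at \<open>i\<close> is 1. Hence another term is nonzero, which yields a partner
        \<open>j\<close> in the same class with sum 1.\<close>
      define c :: "'i \<Rightarrow> bit" where "c = (\<lambda>k\<in>I. of_bool (link I W i k))"
      have ii: "link I W i i" using i by (simp add: link_def equiv_on_gen_def)
      have "(\<Sum>k\<in>I. c k * ?s k) = 0"
        unfolding c_def by (rule less.prems(2)[OF link_indicator_in_cmaps_link[OF i(1)]])
      moreover have "(\<Sum>k\<in>I. c k * ?s k) = 1 + (\<Sum>k\<in>I - {i}. c k * ?s k)"
        using sum.remove[OF assms(1) i(1), of "\<lambda>k. c k * ?s k"] i ii by (simp add: c_def del: add_bit_eq_xor mult_bit_eq_and)
      ultimately have "(\<Sum>k\<in>I - {i}. c k * ?s k) \<noteq> 0" by auto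
      then obtain j where j: "j \<in> I" "j \<noteq> i" "c j * ?s j \<noteq> 0"
        by (metis (no_types, lifting) DiffE insertI1 sum.neutral)
      then have ij: "link I W i j" and sj: "?s j = 1"
        by (auto simp: c_def bit_not_zero_iff split: if_splits)
      from shift[OF ij less.prems(1)] obtain b' where b': "b' \<in> families I V \<C>"
        and s': "\<And>k. k \<in> I \<Longrightarrow>
          sum' (\<lambda>v. b' v k) V = ?s k + (of_bool (k = i) + of_bool (k = j))" by blast
      show ?thesis
      proof (rule less.hyps[OF _ b'])
        show "card {k \<in> I. sum' (\<lambda>v. b' v k) V \<noteq> 0} < card {k \<in> I. ?s k \<noteq> 0}"
        proof (rule psubset_card_mono)
          \<comment> \<open>Adding 1 to the sums at \<open>i\<close> and \<open>j\<close>, both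
            equal to 1, makes them 0; all other sums stay the same.\<close>
          have "sum' (\<lambda>v. b' v k) V \<noteq> 0 \<longleftrightarrow> ?s k \<noteq> 0 \<and> k \<noteq> i \<and> k \<noteq> j" if "k \<in> I" for k
            using s'[OF that] i(2) sj j(2) by (cases "k = i"; cases "k = j") simp_all
          then have "{k \<in> I. sum' (\<lambda>v. b' v k) V \<noteq> 0} = {k \<in> I. ?s k \<noteq> 0} - {i, j}"
            by blast
          then show "{k \<in> I. sum' (\<lambda>v. b' v k) V \<noteq> 0} \<subset> {k \<in> I. ?s k \<noteq> 0}"
            using i by auto
        qed (use assms(1) in simp)
      next
        \<comment> \<open>The shift changes the pairing by \<open>c i + c j\<close>, which vanishes
          because \<open>c\<close> takes equal values at the linked indices \<open>i\<close> and
          \<open>j\<close>.\<close>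
        fix c assume c: "c \<in> cmaps_link I W"
        then have cij: "c i = c j" using ij by (simp add: cmaps_link_def)
        have delta: "(\<Sum>k\<in>I. c k * of_bool (k = l)) = c l" if "l \<in> I" for l
          using assms(1) that
          by (simp add: of_bool_def if_distrib[of "times _"] del: mult_bit_eq_and cong: if_cong)
        have "(\<Sum>k\<in>I. c k * sum' (\<lambda>v. b' v k) V) =
            (\<Sum>k\<in>I. c k * ?s k) + ((\<Sum>k\<in>I. c k * of_bool (k = i)) + (\<Sum>k\<in>I. c k * of_bool (k = j)))"
          by (simp add: s' distrib_left sum.distrib del: add_bit_eq_xor mult_bit_eq_and cong: sum.cong)
        also have "\<dots> = c i + c j"
          by (simp only: delta i(1) j(1) less.prems(2)[OF c] add_0_left)
        also have "\<dots> = 0" by (simp add: cij)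
        finally show "(\<Sum>k\<in>I. c k * sum' (\<lambda>v. b' v k) V) = 0" .
      qed
    qed
  qed
  show ?thesis
    by (rule reduce[OF assms(10)])
      (simp only: assms(11) flip: sum'_families_pairing[OF assms(10,1)])
qed

end
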